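(* Let $n\ge5$ and $\boldsymbol\lambda\in K_n$. Then the group $G_{\boldsymbol\lambda}=\{g_\sigma\in G_n\mid g_\sigma(\boldsymbol\lambda)=\boldsymbol\lambda\}$ is isomorphic to $\mathcal A_{[\boldsymbol\lambda]}$, where $[\boldsymbol\lambda]=\{0,1,\infty,\lambda_1,\dots,\lambda_{n-3}\}\subseteq\widehat{\mathbb C}$.
   Context: $\widehat{\mathbb C}=\mathbb C\cup\{\infty\}$. For $\alpha\subseteq\widehat{\mathbb C}$, $\mathcal A_\alpha$ is the group of all Möbius transformations $f\in\mathrm{PSL}(2,\mathbb C)$ with $f(\alpha)=\alpha$. Let $K_n=\{\boldsymbol{\lambda}=(\lambda_1,\dots,\lambda_{n-3})\in\mathbb C^{n-3}\mid \lambda_i\ne 0,1,\ \lambda_i\ne\lambda_j\ \text{for all } i\neq j\}$. For $\boldsymbol\lambda\in K_n$ put $z_1^{\boldsymbol\lambda}=0$, $z_2^{\boldsymbol\lambda}=1$, $z_3^{\boldsymbol\lambda}=\infty$, $z_{i+3}^{\boldsymbol\lambda}=\lambda_i$ for $1\le i\le n-3$. For $\sigma\in S_n$ let $f_\sigma^{\boldsymbol\lambda}$ be the unique Möbius transformation with $f_\sigma^{\boldsymbol\lambda}(z^{\boldsymbol\lambda}_{\sigma^{-1}(1)})=0$, $f_\sigma^{\boldsymbol\lambda}(z^{\boldsymbol\lambda}_{\sigma^{-1}(2)})=1$, $f_\sigma^{\boldsymbol\lambda}(z^{\boldsymbol\lambda}_{\sigma^{-1}(3)})=\infty$. Define $g_\sigma:K_n\to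 K_n$ by $g_\sigma(\boldsymbol\lambda)=(f_\sigma^{\boldsymbol\lambda}(z^{\boldsymbol\lambda}_{\sigma^{-1}(4)}),\dots,f_\sigma^{\boldsymbol\lambda}(z^{\boldsymbol\lambda}_{\sigma^{-1}(n)}))$. Then $G_n=\{g_\sigma\mid\sigma\in S_n\}$, a group of bijections of $K_n$ under composition. *)

theory Defs
  imports Complex_Main "HOL-Algebra.Bij" "HOL-Combinatorics.Permutations"
begin

text \<open>The Riemann sphere is \<open>complex option\<close>, where \<open>None\<close> is the point at infinity. The
  elements of PSL(2,C) are identified with the maps of the sphere that they induce; scaling the
  coefficients shows that determinant one and nonzero determinant give the same set of maps.\<close>

type_synonym sphere = "complex option"

definition moebius_map ::
    "complex \<Rightarrow> complex \<Rightarrow> complex \<Rightarrow> complex \<Rightarrow> sphere \<Rightarrow> sphere" where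
  "moebius_map a b c d z =
     (case z of
        None \<Rightarrow> if c = 0 then None else Some (a / c)
      | Some w \<Rightarrow> if c * w + d = 0 then None else Some ((a * w + b) / (c * w + d)))"

definition moebius :: "(sphere \<Rightarrow> sphere) set" where
  "moebius = {moebius_map a b c d | a b c d. a * d - b * c \<noteq> 0}"

definition moebius_stabilizer :: "sphere set \<Rightarrow> (sphere \<Rightarrow> sphere) monoid" where
  "moebius_stabilizer \<alpha> = BijGroup UNIV \<lparr>carrier := {f \<in> moebius. f ` \<alpha> = \<alpha>}\<rparr>"

text \<open>A vector in \<open>\<complex>\<^sup>n\<^sup>-\<^sup>3\<close> is a function on the indices \<open>1, \<dots>, n - 3\<close>, made extensional so that
  equality of vectors is equality of functions.\<close>

definition K :: "nat \<Rightarrow> (nat \<Rightarrow> complex) set" where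
  "K n = {l \<in> {1..n-3} \<rightarrow>\<^sub>E UNIV.
            (\<forall>i\<in>{1..n-3}. l i \<noteq> 0 \<and> l i \<noteq> 1) \<and>
            (\<forall>i\<in>{1..n-3}. \<forall>j\<in>{1..n-3}. i \<noteq> j \<longrightarrow> l i \<noteq> l j)}"

text \<open>The marked points are numbered from 1; the value at index 0 is irrelevant.\<close>

definition mark :: "(nat \<Rightarrow> complex) \<Rightarrow> nat \<Rightarrow> sphere" where
  "mark l i = (if i = 1 then Some 0 else if i = 2 then Some 1 else if i = 3 then None
               else Some (l (i - 3)))"

definition normalizer_map :: "(nat \<Rightarrow> nat) \<Rightarrow> (nat \<Rightarrow> complex) \<Rightarrow> sphere \<Rightarrow> sphere" where
  "normalizer_map \<sigma> l = (THE f. f \<in> moebius \<and>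
      f (mark l (inv_into UNIV \<sigma> 1)) = Some 0 \<and>
      f (mark l (inv_into UNIV \<sigma> 2)) = Some 1 \<and>
      f (mark l (inv_into UNIV \<sigma> 3)) = None)"

text \<open>The use of \<open>the\<close> is harmless: \<open>normalizer_map \<sigma> l\<close> is injective and attains infinity at the
  third of the permuted marked points, hence is finite at the remaining ones.\<close>

definition g :: "nat \<Rightarrow> (nat \<Rightarrow> nat) \<Rightarrow> (nat \<Rightarrow> complex) \<Rightarrow> (nat \<Rightarrow> complex)" where
  "g n \<sigma> = (\<lambda>l\<in>K n. \<lambda>i\<in>{1..n-3}. the (normalizer_map \<sigma> l (mark l (inv_into UNIV \<sigma> (i + 3)))))"

definition G :: "nat \<Rightarrow> ((nat \<Rightarrow> complex) \<Rightarrow> (nat \<Rightarrow> complex)) set" where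
  "G n = {g n \<sigma> | \<sigma>. \<sigma> permutes {1..n}}"

definition G_stabilizer ::
    "nat \<Rightarrow> (nat \<Rightarrow> complex) \<Rightarrow> ((nat \<Rightarrow> complex) \<Rightarrow> (nat \<Rightarrow> complex)) monoid" where
  "G_stabilizer n l = BijGroup (K n) \<lparr>carrier := {h \<in> G n. h l = l}\<rparr>"

definition points :: "nat \<Rightarrow> (nat \<Rightarrow> complex) \<Rightarrow> sphere set" where
  "points n l = {Some 0, Some 1, None} \<union> {Some (l i) | i. i \<in> {1..n-3}}"

end

theory Submission
  imports Defs
begin

text \<open>The marked points of \<open>g n \<sigma> l\<close> are the image of the marked points of \<open>l\<close>, renumbered by
  \<open>\<sigma>\<close>, under the normalizing Moebius map. Since a Moebius map is determined by its values at three
  points, \<open>g n \<sigma> l = l\<close> holds exactly when some Moebius map \<open>f\<close> satisfies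
  \<open>f (mark l i) = mark l (\<sigma> i)\<close> for all \<open>i\<close> (\<open>g_transports\<close>, \<open>g_eqI\<close>). Conversely, a Moebius map
  preserving the set of marked points permutes them and thus provides such a \<open>\<sigma>\<close>. Hence the
  Moebius maps that preserve the marked points and the permutations whose \<open>g n \<sigma>\<close> fixes \<open>l\<close>
  correspond bijectively, and the correspondence respects composition.

  What remains is that \<open>g n \<sigma>\<close> determines \<open>\<sigma>\<close>; this is false for four points, where the Klein
  four-group preserves all cross ratios. If \<open>g n \<rho>\<close> were the identity, then every labelled
  configuration of \<open>n\<close> distinct points would admit a Moebius map realizing \<open>\<rho>\<close> on it. Let
  \<open>b = \<rho> a \<noteq> a\<close> and move only the point with label \<open>b\<close>. As \<open>n \<ge> 5\<close>, there are three labels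
  other than \<open>a\<close> and \<open>b\<close>; neither the points with these labels nor their images move, so
  the two Moebius maps coincide. But the image of the point labelled \<open>a\<close> has moved, a contradiction
  (\<open>g_trivial_imp_id\<close>).

  The isomorphism is constructed from the Moebius side, sending \<open>f\<close> to \<open>g n \<sigma>\<close> for the permutation
  \<open>\<sigma>\<close> that \<open>f\<close> induces; in this direction no choice of \<open>\<sigma>\<close> is involved, and faithfulness enters only
  as injectivity.\<close>

abbreviation inv_fun :: "('a \<Rightarrow> 'b) \<Rightarrow> 'b \<Rightarrow> 'a" where
  "inv_fun \<equiv> inv_into UNIV"

section \<open>Moebius transformations and triples of points\<close>

text \<open>The point with homogeneous coordinates \<open>[p : q]\<close>. In these coordinates a Moebius map is a
  linear map, so that compositions and inverses become matrix computations without case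
  distinctions on infinity.\<close>

definition proj :: "complex \<Rightarrow> complex \<Rightarrow> sphere" where
  "proj p q = (if q = 0 then None else Some (p / q))"

lemma proj_cases:
  obtains p q where "z = proj p q" "p \<noteq> 0 \<or> q \<noteq> 0"
proof (cases z)
  case None
  then show ?thesis using that[of 1 0] by (simp add: proj_def)
next
  case (Some w)
  then show ?thesis using that[of w 1] by (simp add: proj_def)
qed

lemma moebius_map_proj:
  assumes "p \<noteq> 0 \<or> q \<noteq> 0"
  shows "moebius_map a b c d (proj p q) = proj (a * p + b * q) (c * p + d * q)"
proof (cases "q = 0")
  case True
  then show ?thesis using assms by (auto simp: moebius_map_def proj_def)
next
  case False
  have "c * (p / q) + d = (c * p + d * q) / q" "a * (p / q) + b = (a * p + b * q) / q"
    using False by (simp_all add: field_simps)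
  then show ?thesis using False by (simp add: moebius_map_def proj_def)
qed

lemma moebius_comp:
  assumes "f \<in> moebius" "h \<in> moebius"
  shows "f \<circ> h \<in> moebius"
proof -
  obtain a b c d where f: "f = moebius_map a b c d" and fd: "a * d - b * c \<noteq> 0"
    using assms(1) by (auto simp: moebius_def)
  obtain a' b' c' d' where h: "h = moebius_map a' b' c' d'" and hd: "a' * d' - b' * c' \<noteq> 0"
    using assms(2) by (auto simp: moebius_def)
  have "(f \<circ> h) z = moebius_map (a * a' + b * c') (a * b' + b * d')
      (c * a' + d * c') (c * b' + d * d') z" for z
  proof -
    obtain p q where z: "z = proj p q" and pq: "p \<noteq> 0 \<or> q \<noteq> 0"
      by (rule proj_cases)
    (* Cramer's rule: an invertible matrix maps no nonzero vector to zero. *)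
    have "a' * p + b' * q \<noteq> 0 \<or> c' * p + d' * q \<noteq> 0"
    proof (rule ccontr)
      assume "\<not> ?thesis"
      then have e: "a' * p + b' * q = 0" "c' * p + d' * q = 0" by auto
      have "(a' * d' - b' * c') * p = d' * (a' * p + b' * q) - b' * (c' * p + d' * q)"
        "(a' * d' - b' * c') * q = a' * (c' * p + d' * q) - c' * (a' * p + b' * q)"
        by (simp_all add: algebra_simps)
      then show False using e hd pq by simp
    qed
    then show ?thesis
      using pq by (simp add: z f h moebius_map_proj algebra_simps)
  qed
  then have "f \<circ> h = moebius_map (a * a' + b * c') (a * b' + b * d')
      (c * a' + d * c') (c * b' + d * d')" by blast
  moreover have "(a * a' + b * c') * (c * b' + d * d') - (a * b' + b * d') * (c * a' + d * c')
      = (a * d - b * c) * (a' * d' - b' * c')"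
    by (simp add: algebra_simps)
  ultimately show ?thesis
    using fd hd unfolding moebius_def by fastforce
qed

lemma moebius_map_scalar: "e \<noteq> 0 \<Longrightarrow> moebius_map e 0 0 e = id"
  by (auto simp: moebius_map_def fun_eq_iff split: option.splits)

lemma id_moebius: "id \<in> moebius"
  unfolding moebius_def using moebius_map_scalar[of 1]
  by (intro CollectI exI[of _ 1] exI[of _ 0]) auto

lemma moebius_left_inverse:
  assumes "f \<in> moebius"
  obtains h where "h \<in> moebius" "h \<circ> f = id"
proof -
  obtain a b c d where f: "f = moebius_map a b c d" and fd: "a * d - b * c \<noteq> 0"
    using assms by (auto simp: moebius_def)
  (* The adjugate matrix; its product with the original one is the determinant times the identity. *)
  define h where "h = moebius_map d (-b) (-c) a"
  have "(h \<circ> f) z = z" for z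
  proof -
    obtain p q where z: "z = proj p q" and pq: "p \<noteq> 0 \<or> q \<noteq> 0"
      by (rule proj_cases)
    have e: "d * (a * p + b * q) + (-b) * (c * p + d * q) = (a * d - b * c) * p"
       "(-c) * (a * p + b * q) + a * (c * p + d * q) = (a * d - b * c) * q"
      by (simp_all add: algebra_simps)
    have "a * p + b * q \<noteq> 0 \<or> c * p + d * q \<noteq> 0"
      using e fd pq by (metis add_0 mult_eq_0_iff)
    then have "(h \<circ> f) z = proj ((a * d - b * c) * p) ((a * d - b * c) * q)"
      unfolding z f h_def comp_apply moebius_map_proj[OF pq] by (subst moebius_map_proj) (simp_all only: e)
    then show ?thesis using fd by (simp add: z proj_def)
  qed
  then have "h \<circ> f = id" by auto
  moreover have "h \<in> moebius"
    using fd unfolding h_def moebius_def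
    by (intro CollectI exI[of _ d] exI[of _ "-b"] exI[of _ "-c"] exI[of _ a]) (simp add: mult.commute)
  ultimately show ?thesis using that by blast
qed

lemma moebius_bij:
  assumes "f \<in> moebius"
  shows "bij f"
proof -
  obtain h where h: "h \<in> moebius" "h \<circ> f = id" by (rule moebius_left_inverse[OF assms])
  obtain k where k: "k \<in> moebius" "k \<circ> h = id" by (rule moebius_left_inverse[OF h(1)])
  have "k = k \<circ> (h \<circ> f)" using h by simp
  also have "\<dots> = f" using k by (simp flip: comp_assoc)
  finally have "f \<circ> h = id" using k by simp
  then show ?thesis using h(2) o_bij by blast
qed

lemma moebius_inv:
  assumes "f \<in> moebius"
  shows "inv_fun f \<in> moebius"
proof -
  obtain h where h: "h \<in> moebius" "h \<circ> f = id" by (rule moebius_left_inverse[OF assms])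
  have "h = inv_fun f"
    using h(2) moebius_bij[OF assms] by (metis comp_assoc comp_id id_comp bij_is_surj surj_iff)
  then show ?thesis using h by simp
qed

lemma moebius_inj: "f \<in> moebius \<Longrightarrow> inj f"
  using moebius_bij bij_is_inj by blast

text \<open>The map is the cross ratio \<open>t \<mapsto> (t - x) (y - z) / ((t - z) (y - x))\<close>; if one of the three
  points is infinity, the two factors that contain it cancel in the limit.\<close>

lemma moebius_to_standard_triple:
  assumes "x \<noteq> y" "y \<noteq> z" "x \<noteq> z"
  obtains f where "f \<in> moebius" "f x = Some 0" "f y = Some 1" "f z = None"
proof -
  have I: thesis if "a * d - b * c \<noteq> 0" "moebius_map a b c d x = Some 0"
    "moebius_map a b c d y = Some 1" "moebius_map a b c d z = None" for a b c d
    using that \<open>\<And>f. f \<in> moebius \<Longrightarrow> f x = Some 0 \<Longrightarrow> f y = Some 1 \<Longrightarrow> f z = None \<Longrightarrow> thesis\<close>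
    unfolding moebius_def by blast
  consider (x) v w where "x = None" "y = Some v" "z = Some w"
    | (y) u w where "x = Some u" "y = None" "z = Some w"
    | (z) u v where "x = Some u" "y = Some v" "z = None"
    | (finite) u v w where "x = Some u" "y = Some v" "z = Some w"
    using assms by (cases x; cases y; cases z) auto
  then show thesis
  proof cases
    case x
    then show ?thesis using assms
      by (intro I[of 0 "-w" "v - w" 1]) (auto simp: moebius_map_def)
  next
    case y
    then show ?thesis using assms
      by (intro I[of 1 "-w" "-u" 1]) (auto simp: moebius_map_def)
  next
    case z
    then show ?thesis using assms
      by (intro I[of 1 "v - u" "-u" 0]) (auto simp: moebius_map_def)
  next
    case finite
    have d: "u \<noteq> v" "v \<noteq> w" "u \<noteq> w" using finite assms by auto
    have "(v - w) * (- w * (v - u)) - (- u * (v - w)) * (v - u) = (v - w) * (v - u) * (u - w)"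
      by (simp add: algebra_simps)
    moreover have "(v - u) * u + - w * (v - u) = (v - u) * (u - w)"
      "(v - u) * v + - w * (v - u) = (v - u) * (v - w)"
      "(v - w) * v + - u * (v - w) = (v - u) * (v - w)"
      "(v - u) * w + - w * (v - u) = 0"
      "(v - w) * u + - u * (v - w) = 0"
      by (simp_all add: algebra_simps)
    ultimately show ?thesis using d finite
      by (intro I[of "v - w" "- w * (v - u)" "- u * (v - w)" "v - u"])
         (simp_all only: moebius_map_def option.case, auto)
  qed
qed

lemma moebius_fixing_standard_triple:
  assumes "f \<in> moebius" "f (Some 0) = Some 0" "f (Some 1) = Some 1" "f None = None"
  shows "f = id"
proof -
  obtain a b c d where f: "f = moebius_map a b c d" and fd: "a * d - b * c \<noteq> 0"
    using assms by (auto simp: moebius_def)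
  have "c = 0" using assms(4) by (simp add: f moebius_map_def split: if_splits)
  moreover from this have "b = 0" using assms(2) fd by (simp add: f moebius_map_def split: if_splits)
  moreover from calculation have "a = d" "d \<noteq> 0"
    using assms(3) fd by (simp_all add: f moebius_map_def split: if_splits)
  ultimately show ?thesis using f moebius_map_scalar by blast
qed

text \<open>Conjugating \<open>inv h \<circ> f\<close> moves the three common points to \<open>0, 1, \<infinity>\<close>, where fixing them
  forces the coefficients to be scalar.\<close>

lemma moebius_eq_if_agree_on_triple:
  assumes "f \<in> moebius" "h \<in> moebius" "x \<noteq> y" "y \<noteq> z" "x \<noteq> z"
    and "f x = h x" "f y = h y" "f z = h z"
  shows "f = h"
proof -
  obtain k where k: "k \<in> moebius" "k x = Some 0" "k y = Some 1" "k z = None"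
    using moebius_to_standard_triple assms(3-5) by metis
  define m where "m = k \<circ> (inv_fun h \<circ> f) \<circ> inv_fun k"
  have ik: "inv_fun k (Some 0) = x" "inv_fun k (Some 1) = y" "inv_fun k None = z"
    using k moebius_inj[OF k(1)] by (metis inv_f_f)+
  have "m \<in> moebius" unfolding m_def using assms k by (intro moebius_comp moebius_inv)
  moreover have "m (Some 0) = Some 0" "m (Some 1) = Some 1" "m None = None"
    using assms k by (simp_all add: m_def ik inv_f_f[OF moebius_inj])
  ultimately have m: "m = id" by (rule moebius_fixing_standard_triple)
  have "f w = h w" for w
  proof -
    have "k (inv_fun h (f w)) = k w"
      using fun_cong[OF m, of "k w"] by (simp add: m_def inv_f_f[OF moebius_inj[OF k(1)]])
    then have "inv_fun h (f w) = w" using moebius_inj[OF k(1)] by (simp add: inj_eq)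
    then show ?thesis using moebius_bij[OF assms(2)] by (metis bij_inv_eq_iff)
  qed
  then show ?thesis by blast
qed

section \<open>Marked configurations\<close>

lemma inj_on_mark:
  assumes "l \<in> K n"
  shows "inj_on (mark l) {1..n}"
proof (rule inj_onI)
  fix i j assume ij: "i \<in> {1..n}" "j \<in> {1..n}" and eq: "mark l i = mark l j"
  have *: "l (k - 3) \<noteq> 0" "l (k - 3) \<noteq> 1" if "k \<in> {1..n}" "k > 3" for k
  proof -
    have "k - 3 \<in> {1..n-3}" using that by auto
    then show "l (k - 3) \<noteq> 0" "l (k - 3) \<noteq> 1" using assms unfolding K_def by blast+
  qed
  have **: "i = j" if "i > 3" "j > 3"
  proof -
    have "i - 3 \<in> {1..n-3}" "j - 3 \<in> {1..n-3}" using that ij by auto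
    moreover have "l (i - 3) = l (j - 3)" using eq that by (simp add: mark_def)
    ultimately have "i - 3 = j - 3" using assms unfolding K_def by blast
    then show ?thesis using that by simp
  qed
  consider "i > 3" "j > 3" | "i = 1 \<or> i = 2 \<or> i = 3" | "j = 1 \<or> j = 2 \<or> j = 3"
    using ij by (auto simp: linorder_not_less) linarith
  then show "i = j"
  proof cases
    case 1
    then show ?thesis using ** by blast
  next
    case 2
    then show ?thesis
      using eq *[of j] ij by (cases "j > 3") (auto simp: mark_def split: if_splits)
  next
    case 3
    then show ?thesis
      using eq *[of i] ij by (cases "i > 3") (auto simp: mark_def split: if_splits)
  qed
qed

lemma mark_image:
  assumes "n \<ge> 3"
  shows "mark l ` {1..n} = points n l"
proof
  show "mark l ` {1..n} \<subseteq> points n l"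
  proof
    fix z assume "z \<in> mark l ` {1..n}"
    then obtain i where i: "i \<in> {1..n}" "z = mark l i" by blast
    show "z \<in> points n l"
    proof (cases "i > 3")
      case True
      then have "i - 3 \<in> {1..n-3}" "z = Some (l (i - 3))" using i by (auto simp: mark_def)
      then show ?thesis unfolding points_def by blast
    next
      case False
      then have "i = 1 \<or> i = 2 \<or> i = 3" using i by auto
      then show ?thesis using i by (auto simp: mark_def points_def)
    qed
  qed
next
  have "Some 0 = mark l 1" "Some 1 = mark l 2" "None = mark l 3"
    by (simp_all add: mark_def)
  then have a: "{Some 0, Some 1, None} \<subseteq> mark l ` {1..n}" using assms by auto
  have "Some (l i) \<in> mark l ` {1..n}" if "i \<in> {1..n-3}" for i
  proof -
    have "Some (l i) = mark l (i + 3)" "i + 3 \<in> {1..n}" using that by (auto simp: mark_def)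
    then show ?thesis by blast
  qed
  with a show "points n l \<subseteq> mark l ` {1..n}" unfolding points_def by blast
qed

lemma eq_if_mark_eq:
  assumes "l \<in> K n" "l' \<in> K n" "\<And>i. i \<in> {1..n} \<Longrightarrow> mark l i = mark l' i"
  shows "l = l'"
proof (rule extensionalityI[of _ "{1..n-3}"])
  show "l \<in> extensional {1..n-3}" "l' \<in> extensional {1..n-3}"
    using assms by (auto simp: K_def PiE_def)
  fix i assume "i \<in> {1..n-3}"
  then show "l i = l' i" using assms(3)[of "i + 3"] by (auto simp: mark_def)
qed

text \<open>\<open>K n\<close> parametrizes all \<open>n\<close>-tuples of distinct points that start with \<open>0, 1, \<infinity>\<close>: distinctness
  from the third point makes the remaining ones finite, so that \<open>the\<close> loses nothing.\<close>

lemma normalized_configuration: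
  assumes "n \<ge> 3" "inj_on x {1..n}" "x 1 = Some 0" "x 2 = Some 1" "x 3 = None"
  defines "l \<equiv> \<lambda>i\<in>{1..n-3}. the (x (i + 3))"
  shows "l \<in> K n" "\<And>i. i \<in> {1..n} \<Longrightarrow> mark l i = x i"
proof -
  have in_range: "i + 3 \<in> {1..n}" if "i \<in> {1..n-3}" for i
    using that assms(1) by auto
  have xl: "x (i + 3) = Some (l i)" if "i \<in> {1..n-3}" for i
  proof -
    have "x (i + 3) \<noteq> x 3"
      using that in_range[OF that] assms(1) inj_onD[OF assms(2), of "i + 3" 3] by auto
    then show ?thesis using that assms(5) by (auto simp: l_def)
  qed
  have nz: "l i \<noteq> 0" "l i \<noteq> 1" if "i \<in> {1..n-3}" for i
  proof -
    have "x (i + 3) \<noteq> x 1" "x (i + 3) \<noteq> x 2"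
      using that in_range[OF that] assms(1) inj_onD[OF assms(2), of "i + 3" 1] inj_onD[OF assms(2), of "i + 3" 2]
      by auto
    then show "l i \<noteq> 0" "l i \<noteq> 1" using xl[OF that] assms by auto
  qed
  have di: "l i \<noteq> l j" if "i \<in> {1..n-3}" "j \<in> {1..n-3}" "i \<noteq> j" for i j
  proof -
    have "x (i + 3) \<noteq> x (j + 3)"
      using that in_range inj_onD[OF assms(2), of "i + 3" "j + 3"] by auto
    then show ?thesis using xl that by simp
  qed
  have "l \<in> extensional {1..n-3}" unfolding l_def by simp
  then show "l \<in> K n" using nz di unfolding K_def PiE_def by auto
  show "mark l i = x i" if "i \<in> {1..n}" for i
  proof (cases "i > 3")
    case True
    then have "i - 3 \<in> {1..n-3}" "i - 3 + 3 = i" using that by auto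
    then show ?thesis using xl[of "i - 3"] True by (simp add: mark_def)
  next
    case False
    then have "i = 1 \<or> i = 2 \<or> i = 3" using that by auto
    then show ?thesis using assms by (auto simp: mark_def)
  qed
qed

text \<open>The relation through which \<open>g\<close> is handled below: given \<open>\<sigma>\<close> and \<open>l\<close>, it determines both the
  Moebius map and the target, and it composes. The permutation is placed on the target side, which avoids
  the inverse of \<open>\<sigma>\<close>.\<close>

definition transports ::
    "nat \<Rightarrow> (sphere \<Rightarrow> sphere) \<Rightarrow> (nat \<Rightarrow> nat) \<Rightarrow> (nat \<Rightarrow> complex) \<Rightarrow> (nat \<Rightarrow> complex) \<Rightarrow> bool" where
  "transports n f \<sigma> l l' \<longleftrightarrow> f \<in> moebius \<and> (\<forall>i\<in>{1..n}. f (mark l i) = mark l' (\<sigma> i))"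

lemma transports_comp:
  assumes "transports n f \<sigma> l l'" "transports n h \<tau> l' l''" "\<sigma> permutes {1..n}"
  shows "transports n (h \<circ> f) (\<tau> \<circ> \<sigma>) l l''"
  using assms permutes_in_image[OF assms(3)] unfolding transports_def
  by (auto intro: moebius_comp)

lemma transports_unique:
  assumes "transports n f \<sigma> l l'" "transports n h \<sigma> l l'" "l \<in> K n" "n \<ge> 3"
  shows "f = h"
proof (rule moebius_eq_if_agree_on_triple)
  show "mark l 1 \<noteq> mark l 2" "mark l 2 \<noteq> mark l 3" "mark l 1 \<noteq> mark l 3"
    by (simp_all add: mark_def)
qed (use assms in \<open>auto simp: transports_def\<close>)

lemma g_transports:
  assumes "l \<in> K n" "\<sigma> permutes {1..n}" "n \<ge> 3"
  shows "g n \<sigma> l \<in> K n" "transports n (normalizer_map \<sigma> l) \<sigma> l (g n \<sigma> l)"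
proof -
  let ?x = "\<lambda>i. mark l (inv_fun \<sigma> i)"
  have inv_in: "inv_fun \<sigma> i \<in> {1..n}" if "i \<in> {1..n}" for i
    using permutes_in_image[OF permutes_inv[OF assms(2)]] that by blast
  have inv_inj: "inv_fun \<sigma> i = inv_fun \<sigma> j \<Longrightarrow> i = j" for i j
    using permutes_inj[OF permutes_inv[OF assms(2)]] by (simp add: inj_eq)
  have inj: "inj_on ?x {1..n}"
    using inj_on_mark[OF assms(1)] inv_in inv_inj by (meson inj_onD inj_onI)
  have d: "?x 1 \<noteq> ?x 2" "?x 2 \<noteq> ?x 3" "?x 1 \<noteq> ?x 3"
    using inj_onD[OF inj, of 1 2] inj_onD[OF inj, of 2 3] inj_onD[OF inj, of 1 3] assms(3) by auto
  let ?P = "\<lambda>f. f \<in> moebius \<and> f (?x 1) = Some 0 \<and> f (?x 2) = Some 1 \<and> f (?x 3) = None"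
  obtain f where f: "?P f" using moebius_to_standard_triple[OF d] by metis
  have "h = f" if "?P h" for h
    using moebius_eq_if_agree_on_triple[of h f, OF _ _ d] f that by auto
  with f have N: "?P (normalizer_map \<sigma> l)"
    unfolding normalizer_map_def by (rule theI[where P = ?P])
  let ?y = "\<lambda>i. normalizer_map \<sigma> l (?x i)"
  have injy: "inj_on ?y {1..n}"
    using N by (intro comp_inj_on[OF inj, unfolded comp_def] inj_on_subset[OF moebius_inj]) auto
  have gy: "g n \<sigma> l = (\<lambda>i\<in>{1..n-3}. the (?y (i + 3)))"
    using assms(1) by (simp add: g_def)
  have y: "?y 1 = Some 0" "?y 2 = Some 1" "?y 3 = None" using N by auto
  show "g n \<sigma> l \<in> K n" unfolding gy
    by (rule normalized_configuration(1)[of n ?y, OF assms(3) injy y])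
  have m: "mark (g n \<sigma> l) i = ?y i" if "i \<in> {1..n}" for i
    unfolding gy by (rule normalized_configuration(2)[of n ?y, OF assms(3) injy y that])
  show "transports n (normalizer_map \<sigma> l) \<sigma> l (g n \<sigma> l)"
    unfolding transports_def
  proof (intro conjI ballI)
    show "normalizer_map \<sigma> l \<in> moebius" using N by blast
    fix i assume "i \<in> {1..n}"
    then have "\<sigma> i \<in> {1..n}" using permutes_in_image[OF assms(2)] by blast
    then show "normalizer_map \<sigma> l (mark l i) = mark (g n \<sigma> l) (\<sigma> i)"
      using m permutes_inverses[OF assms(2)] by simp
  qed
qed

text \<open>Any two targets start with \<open>0, 1, \<infinity>\<close>, so the two maps agree on the preimages of these three
  points.\<close>

lemma transports_target_unique:
  assumes "transports n f \<sigma> l l'" "transports n h \<sigma> l l''" "\<sigma> permutes {1..n}"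
    "l' \<in> K n" "l'' \<in> K n" "n \<ge> 3"
  shows "l' = l''"
proof -
  have *: "f (mark l (inv_fun \<sigma> i)) = mark l' i" "h (mark l (inv_fun \<sigma> i)) = mark l'' i"
    if "i \<in> {1..n}" for i
    using assms(1,2) that permutes_inverses[OF assms(3)]
      permutes_in_image[OF permutes_inv[OF assms(3)]] unfolding transports_def by metis+
  define x where "x = (\<lambda>i. mark l (inv_fun \<sigma> i))"
  have fm: "f \<in> moebius" and hm: "h \<in> moebius" using assms by (auto simp: transports_def)
  have r: "i \<in> {1..n} \<Longrightarrow> f (x i) = mark l' i" "i \<in> {1..n} \<Longrightarrow> h (x i) = mark l'' i" for i
    using * by (auto simp: x_def)
  have e: "f (x i) = h (x i)" if "i \<in> {1,2,3}" for i
    using r[of i] that assms(6) by (auto simp: mark_def)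
  have "f (x 1) \<noteq> f (x 2)" "f (x 2) \<noteq> f (x 3)" "f (x 1) \<noteq> f (x 3)"
    using r(1)[of 1] r(1)[of 2] r(1)[of 3] assms(6) by (auto simp: mark_def)
  then have "x 1 \<noteq> x 2" "x 2 \<noteq> x 3" "x 1 \<noteq> x 3" by metis+
  then have "f = h"
    using moebius_eq_if_agree_on_triple[OF fm hm, of "x 1" "x 2" "x 3"] e by simp
  then show ?thesis using r eq_if_mark_eq[OF assms(4,5)] by metis
qed

lemma g_eqI:
  assumes "transports n f \<sigma> l l'" "\<sigma> permutes {1..n}" "l \<in> K n" "l' \<in> K n" "n \<ge> 3"
  shows "g n \<sigma> l = l'"
  using transports_target_unique g_transports assms by metis

lemma g_comp:
  assumes "l \<in> K n" "\<sigma> permutes {1..n}" "\<tau> permutes {1..n}" "n \<ge> 3"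
  shows "g n \<tau> (g n \<sigma> l) = g n (\<tau> \<circ> \<sigma>) l"
proof -
  note s = g_transports[OF assms(1,2,4)]
  note t = g_transports[OF s(1) assms(3,4)]
  show ?thesis
    using g_eqI[OF transports_comp[OF s(2) t(2) assms(2)]] permutes_compose[OF assms(2,3)]
      assms t(1) by simp
qed

lemma g_id: "l \<in> K n \<Longrightarrow> n \<ge> 3 \<Longrightarrow> g n id l = l"
  by (rule g_eqI[of n id]) (auto simp: transports_def id_moebius permutes_id)

lemma g_inverse:
  assumes "l \<in> K n" "\<sigma> permutes {1..n}" "n \<ge> 3"
  shows "g n (inv_fun \<sigma>) (g n \<sigma> l) = l" "g n \<sigma> (g n (inv_fun \<sigma>) l) = l"
  by (simp_all only: g_comp[OF assms(1,2) permutes_inv[OF assms(2)] assms(3)]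
      g_comp[OF assms(1) permutes_inv[OF assms(2)] assms(2,3)]
      permutes_inv_o[OF assms(2)] g_id[OF assms(1,3)])

section \<open>Faithfulness of the action\<close>

text \<open>A statement about normalized configurations becomes one about all configurations by
  conjugating with the map that normalizes them. This frees the argument below from the special
  role of the labels 1, 2 and 3.\<close>

lemma g_trivial_imp_symmetric_configurations:
  assumes "n \<ge> 3" "\<rho> permutes {1..n}" "\<forall>l\<in>K n. g n \<rho> l = l" "inj_on x {1..n}"
  obtains f where "f \<in> moebius" "\<And>i. i \<in> {1..n} \<Longrightarrow> f (x i) = x (\<rho> i)"
proof -
  have d: "x 1 \<noteq> x 2" "x 2 \<noteq> x 3" "x 1 \<noteq> x 3"
    using inj_onD[OF assms(4), of 1 2] inj_onD[OF assms(4), of 2 3] inj_onD[OF assms(4), of 1 3]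
      assms(1) by auto
  obtain m where m: "m \<in> moebius" "m (x 1) = Some 0" "m (x 2) = Some 1" "m (x 3) = None"
    using moebius_to_standard_triple[OF d] by metis
  note mi = moebius_inj[OF m(1)]
  have "inj_on (m \<circ> x) {1..n}"
    by (intro comp_inj_on[OF assms(4)] inj_on_subset[OF mi]) simp
  then obtain l where l: "l \<in> K n" "\<And>i. i \<in> {1..n} \<Longrightarrow> mark l i = m (x i)"
    using normalized_configuration[of n "m \<circ> x"] assms(1) m by auto
  obtain h where h: "h \<in> moebius" "\<And>i. i \<in> {1..n} \<Longrightarrow> h (mark l i) = mark l (\<rho> i)"
    using g_transports(2)[OF l(1) assms(2,1)] bspec[OF assms(3) l(1)] by (auto simp: transports_def)
  have "(inv_fun m \<circ> h \<circ> m) (x i) = x (\<rho> i)" if "i \<in> {1..n}" for i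
    using h(2)[OF that] l(2) that permutes_in_image[OF assms(2), of i] mi by simp
  moreover have "inv_fun m \<circ> h \<circ> m \<in> moebius" using m h by (intro moebius_comp moebius_inv)
  ultimately show ?thesis using that by blast
qed

lemma three_further_indices:
  assumes "n \<ge> 5"
  obtains i j k :: nat where "distinct [i, j, k]" "{i, j, k} \<subseteq> {1..n} - {a, b}"
proof -
  have "card {1..n} \<le> card ({1..n} - {a, b}) + card {a, b}"
    using card_Un_le[of "{1..n} - {a, b}" "{a, b}"] card_mono[of "{1..n} - {a,b} \<union> {a, b}" "{1..n}"]
    by fastforce
  with assms have "3 \<le> card ({1..n} - {a, b})" using card_insert_le_m1[of 2 "{b}" a] by simp
  then obtain T where "T \<subseteq> {1..n} - {a, b}" "card T = 3"
    by (meson obtain_subset_with_card_n)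
  then obtain i j k where "T = {i, j, k}" "distinct [i, j, k]"
    by (auto simp: card_3_iff)
  then show ?thesis using \<open>T \<subseteq> _\<close> that[of i j k] by auto
qed

text \<open>Two configurations that differ only at the label \<open>b = \<rho> a\<close> are compared. A map realizing \<open>\<rho>\<close>
  is determined by its values at three labels outside \<open>{a, b}\<close>, hence is the same for both, although
  it should send the point labelled \<open>a\<close> to two different places.\<close>

lemma g_trivial_imp_id:
  assumes n: "n \<ge> 5" and \<rho>: "\<rho> permutes {1..n}" and triv: "\<forall>l\<in>K n. g n \<rho> l = l"
  shows "\<rho> = id"
proof (rule ccontr)
  assume "\<rho> \<noteq> id"
  then obtain a where a: "\<rho> a \<noteq> a" by (metis eq_id_iff)
  define b where "b = \<rho> a"
  have ab: "a \<noteq> b" "a \<in> {1..n}" "b \<in> {1..n}"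
    using a \<rho> permutes_in_image[OF \<rho>, of a] unfolding b_def by (metis permutes_not_in)+
  obtain i j k where ijk: "distinct [i, j, k]" "{i, j, k} \<subseteq> {1..n} - {a, b}"
    using three_further_indices[OF n] by metis
  have n3: "n \<ge> 3" using n by simp
  (* Any injective configuration serves; moving the point b to infinity keeps it injective. *)
  define x :: "nat \<Rightarrow> sphere" where "x = (\<lambda>m. Some (of_nat m))"
  define x' where "x' = x(b := None)"
  have inj: "inj_on x {1..n}" "inj_on x' {1..n}"
    by (auto simp: inj_on_def x_def x'_def)
  obtain f where f: "f \<in> moebius" "\<And>m. m \<in> {1..n} \<Longrightarrow> f (x m) = x (\<rho> m)"
    by (rule g_trivial_imp_symmetric_configurations[OF n3 \<rho> triv inj(1)]) (rule that)
  obtain f' where f': "f' \<in> moebius" "\<And>m. m \<in> {1..n} \<Longrightarrow> f' (x' m) = x' (\<rho> m)"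
    by (rule g_trivial_imp_symmetric_configurations[OF n3 \<rho> triv inj(2)]) (rule that)
  have agree: "f (x m) = f' (x m)" if "m \<in> {i, j, k}" for m
  proof -
    have "m \<in> {1..n}" "m \<noteq> a" "m \<noteq> b" using that ijk by auto
    moreover have "\<rho> m \<noteq> b"
      using \<open>m \<noteq> a\<close> permutes_inj[OF \<rho>] by (simp add: b_def inj_eq)
    ultimately show ?thesis using f(2)[of m] f'(2)[of m] by (simp add: x'_def)
  qed
  have "f = f'"
    using moebius_eq_if_agree_on_triple[OF f(1) f'(1), of "x i" "x j" "x k"] agree ijk
    by (auto simp: x_def)
  moreover have "f (x a) = x b" "f' (x a) = None"
    using f(2)[OF ab(2)] f'(2)[OF ab(2)] ab(1) by (auto simp: x'_def b_def)
  ultimately show False by (simp add: x_def)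
qed

lemma g_inject:
  assumes "n \<ge> 5" "\<sigma> permutes {1..n}" "\<tau> permutes {1..n}" "g n \<sigma> = g n \<tau>"
  shows "\<sigma> = \<tau>"
proof -
  have "inv_fun \<tau> \<circ> \<sigma> = id"
  proof (rule g_trivial_imp_id[OF assms(1) _ ballI])
    show "inv_fun \<tau> \<circ> \<sigma> permutes {1..n}"
      using assms by (intro permutes_compose permutes_inv)
    fix l assume l: "l \<in> K n"
    have "g n (inv_fun \<tau> \<circ> \<sigma>) l = g n (inv_fun \<tau>) (g n \<tau> l)"
      using g_comp[OF l assms(2) permutes_inv[OF assms(3)]] assms(1,4) by simp
    also have "\<dots> = l"
      using g_inverse(1)[OF l assms(3)] assms(1) by simp
    finally show "g n (inv_fun \<tau> \<circ> \<sigma>) l = l" .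
  qed
  then have "\<tau> \<circ> (inv_fun \<tau> \<circ> \<sigma>) = \<tau>" by simp
  then show ?thesis using permutes_inv_o(1)[OF assms(3)] by (metis comp_assoc id_comp)
qed

section \<open>The two stabilizers\<close>

lemma g_Bij:
  assumes "n \<ge> 3" "\<sigma> permutes {1..n}"
  shows "g n \<sigma> \<in> Bij (K n)"
proof -
  note p = permutes_inv[OF assms(2)]
  have "g n \<sigma> ` K n \<subseteq> K n" "g n (inv_fun \<sigma>) ` K n \<subseteq> K n"
    using g_transports(1) assms p by blast+
  moreover have "g n (inv_fun \<sigma>) (g n \<sigma> l) = l" "g n \<sigma> (g n (inv_fun \<sigma>) l) = l" if "l \<in> K n" for l
    using g_inverse[OF that assms(2,1)] by blast+
  ultimately have "bij_betw (g n \<sigma>) (K n) (K n)"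
    by (intro bij_betw_byWitness[where f' = "g n (inv_fun \<sigma>)"]) auto
  then show ?thesis by (simp add: Bij_def g_def)
qed

lemma compose_g:
  assumes "n \<ge> 3" "\<sigma> permutes {1..n}" "\<tau> permutes {1..n}"
  shows "compose (K n) (g n \<tau>) (g n \<sigma>) = g n (\<tau> \<circ> \<sigma>)"
proof (rule extensionalityI[of _ "K n"])
  show "compose (K n) (g n \<tau>) (g n \<sigma>) \<in> extensional (K n)" "g n (\<tau> \<circ> \<sigma>) \<in> extensional (K n)"
    by (simp_all add: compose_def g_def)
qed (use g_comp assms in \<open>simp add: compose_eq\<close>)

lemma g_id_eq: "n \<ge> 3 \<Longrightarrow> g n id = (\<lambda>l\<in>K n. l)"
  by (rule extensionalityI[of _ "K n"]) (auto simp: g_id, simp add: g_def)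

lemma subgroup_G_stabilizer:
  assumes "n \<ge> 3" "l \<in> K n"
  shows "subgroup {h \<in> G n. h l = l} (BijGroup (K n))"
proof (rule group.subgroupI[OF group_BijGroup])
  show sub: "{h \<in> G n. h l = l} \<subseteq> carrier (BijGroup (K n))"
    using g_Bij[OF assms(1)] by (auto simp: G_def BijGroup_def)
  have "g n id \<in> {h \<in> G n. h l = l}"
    using g_id assms permutes_id by (auto simp: G_def)
  then show "{h \<in> G n. h l = l} \<noteq> {}" by blast
next
  fix h assume "h \<in> {h \<in> G n. h l = l}"
  then obtain \<sigma> where s: "\<sigma> permutes {1..n}" "h = g n \<sigma>" "g n \<sigma> l = l" by (auto simp: G_def)
  note p = permutes_inv[OF s(1)]
  have "inv\<^bsub>BijGroup (K n)\<^esub> h = g n (inv_fun \<sigma>)"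
  proof (rule group.inv_equality[OF group_BijGroup])
    show "h \<in> carrier (BijGroup (K n))" "g n (inv_fun \<sigma>) \<in> carrier (BijGroup (K n))"
      using g_Bij[OF assms(1)] s p by (auto simp: BijGroup_def)
    show "g n (inv_fun \<sigma>) \<otimes>\<^bsub>BijGroup (K n)\<^esub> h = \<one>\<^bsub>BijGroup (K n)\<^esub>"
      using g_Bij[OF assms(1) s(1)] g_Bij[OF assms(1) p]
      by (simp add: BijGroup_def s(2) compose_g[OF assms(1) s(1) p] permutes_inv_o[OF s(1)]
          g_id_eq[OF assms(1)])
  qed
  moreover have "g n (inv_fun \<sigma>) l = l"
    using g_inverse(1)[OF assms(2) s(1) assms(1)] s(3) by simp
  ultimately show "inv\<^bsub>BijGroup (K n)\<^esub> h \<in> {h \<in> G n. h l = l}"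
    using p by (auto simp: G_def)
next
  fix h k assume "h \<in> {h \<in> G n. h l = l}" "k \<in> {h \<in> G n. h l = l}"
  then obtain \<sigma> \<tau> where s: "\<sigma> permutes {1..n}" "h = g n \<sigma>" "g n \<sigma> l = l"
    and t: "\<tau> permutes {1..n}" "k = g n \<tau>" "g n \<tau> l = l" by (auto simp: G_def)
  have "h \<otimes>\<^bsub>BijGroup (K n)\<^esub> k = g n (\<sigma> \<circ> \<tau>)"
    using g_Bij[OF assms(1) s(1)] g_Bij[OF assms(1) t(1)]
    by (simp add: BijGroup_def s(2) t(2) compose_g[OF assms(1) t(1) s(1)])
  moreover have "g n (\<sigma> \<circ> \<tau>) l = l" using g_comp[OF assms(2) t(1) s(1) assms(1)] s t by simp
  ultimately show "h \<otimes>\<^bsub>BijGroup (K n)\<^esub> k \<in> {h \<in> G n. h l = l}"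
    using permutes_compose[OF t(1) s(1)] by (auto simp: G_def)
qed

lemma moebius_Bij: "f \<in> moebius \<Longrightarrow> f \<in> Bij UNIV"
  using moebius_bij by (auto simp: Bij_def)

lemma subgroup_moebius_stabilizer:
  "subgroup {f \<in> moebius. f ` \<alpha> = \<alpha>} (BijGroup UNIV)"
proof (rule group.subgroupI[OF group_BijGroup])
  show "{f \<in> moebius. f ` \<alpha> = \<alpha>} \<subseteq> carrier (BijGroup UNIV)"
    using moebius_Bij by (auto simp: BijGroup_def)
  show "{f \<in> moebius. f ` \<alpha> = \<alpha>} \<noteq> {}" using id_moebius by force
next
  fix f assume f: "f \<in> {f \<in> moebius. f ` \<alpha> = \<alpha>}"
  have "inv\<^bsub>BijGroup UNIV\<^esub> f = inv_fun f"
    using inv_BijGroup[of f UNIV] f moebius_Bij by (simp add: restrict_UNIV)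
  moreover have "inv_fun f ` \<alpha> = \<alpha>" 
    using f image_inv_f_f[OF moebius_inj, of f \<alpha>] by simp
  ultimately show "inv\<^bsub>BijGroup UNIV\<^esub> f \<in> {f \<in> moebius. f ` \<alpha> = \<alpha>}"
    using f moebius_inv by auto
next
  fix f h assume fh: "f \<in> {f \<in> moebius. f ` \<alpha> = \<alpha>}" "h \<in> {f \<in> moebius. f ` \<alpha> = \<alpha>}"
  then have "f \<otimes>\<^bsub>BijGroup UNIV\<^esub> h = f \<circ> h"
    by (auto simp: BijGroup_def moebius_Bij compose_def)
  moreover have "(f \<circ> h) ` \<alpha> = \<alpha>" 
    unfolding image_comp[symmetric] using fh by simp
  ultimately show "f \<otimes>\<^bsub>BijGroup UNIV\<^esub> h \<in> {f \<in> moebius. f ` \<alpha> = \<alpha>}"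
    using fh moebius_comp by auto
qed

definition mark_perm :: "nat \<Rightarrow> (nat \<Rightarrow> complex) \<Rightarrow> (sphere \<Rightarrow> sphere) \<Rightarrow> nat \<Rightarrow> nat" where
  "mark_perm n l f i = (if i \<in> {1..n} then inv_into {1..n} (mark l) (f (mark l i)) else i)"

lemma mark_perm_transports:
  assumes "f \<in> moebius" "f ` points n l = points n l" "l \<in> K n" "n \<ge> 3"
  shows "mark_perm n l f permutes {1..n}" "transports n f (mark_perm n l f) l l"
proof -
  note im = mark_image[OF assms(4), of l]
  have b: "bij_betw (mark l) {1..n} (points n l)"
    using inj_on_mark[OF assms(3)] im by (simp add: bij_betw_def)
  have "bij_betw f (points n l) (points n l)"
    using moebius_inj[OF assms(1)] assms(2) by (auto simp: bij_betw_def intro: inj_on_subset)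
  then have "bij_betw (inv_into {1..n} (mark l) \<circ> f \<circ> mark l) {1..n} {1..n}"
    using b by (meson bij_betw_inv_into bij_betw_trans)
  then have "bij_betw (mark_perm n l f) {1..n} {1..n}"
    by (rule bij_betw_cong[THEN iffD1, rotated]) (simp add: mark_perm_def)
  then show "mark_perm n l f permutes {1..n}"
    by (rule bij_imp_permutes) (auto simp: mark_perm_def)
  have "mark l (mark_perm n l f i) = f (mark l i)" if "i \<in> {1..n}" for i
  proof -
    have "mark l i \<in> points n l" using that im by blast
    then have "f (mark l i) \<in> mark l ` {1..n}" using im assms(2) by blast
    then show ?thesis using that by (simp add: mark_perm_def f_inv_into_f)
  qed
  then show "transports n f (mark_perm n l f) l l"
    using assms(1) by (simp add: transports_def)
qed

text \<open>This yields both multiplicativity of \<open>mark_perm\<close> and the fact that it inverts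
  \<open>\<sigma> \<mapsto> normalizer_map \<sigma> l\<close> on the permutations with \<open>g n \<sigma> l = l\<close>.\<close>

lemma mark_perm_unique:
  assumes "transports n f \<sigma> l l" "\<sigma> permutes {1..n}" "l \<in> K n"
  shows "mark_perm n l f = \<sigma>"
proof
  fix i
  show "mark_perm n l f i = \<sigma> i"
  proof (cases "i \<in> {1..n}")
    case True
    then show ?thesis using assms(1) inv_into_f_f[OF inj_on_mark[OF assms(3)]]
      permutes_in_image[OF assms(2), of i] by (simp add: mark_perm_def transports_def)
  next
    case False
    then show ?thesis using permutes_not_in[OF assms(2) False] unfolding mark_perm_def by (simp only: if_False)
  qed
qed

lemma transports_stabilizes_points:
  assumes "transports n f \<sigma> l l" "\<sigma> permutes {1..n}" "n \<ge> 3"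
  shows "f ` points n l = points n l"
proof -
  have "f ` mark l ` {1..n} = mark l ` \<sigma> ` {1..n}"
    using assms(1) unfolding transports_def image_image by (intro image_cong) auto
  then show ?thesis using mark_image[OF assms(3), of l] permutes_image[OF assms(2)] by simp
qed

theorem theorem5:
  fixes n :: nat and l :: "nat \<Rightarrow> complex"
  assumes "n \<ge> 5" and "l \<in> K n"
  shows "group (G_stabilizer n l) \<and> G_stabilizer n l \<cong> moebius_stabilizer (points n l)"
proof
  have n3: "n \<ge> 3" using assms(1) by simp
  let ?A = "moebius_stabilizer (points n l)" and ?G = "G_stabilizer n l"
  define \<psi> where "\<psi> f = g n (mark_perm n l f)" for f
  show "group ?G"
    unfolding G_stabilizer_def
    by (rule group.subgroup_imp_group[OF group_BijGroup subgroup_G_stabilizer[OF n3 assms(2)]])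
  have A: "group ?A"
    unfolding moebius_stabilizer_def
    by (rule group.subgroup_imp_group[OF group_BijGroup subgroup_moebius_stabilizer])
  have cA: "carrier ?A = {f \<in> moebius. f ` points n l = points n l}"
    by (simp add: moebius_stabilizer_def)
  have cG: "carrier ?G = {h \<in> G n. h l = l}"
    by (simp add: G_stabilizer_def)
  have perm: "mark_perm n l f permutes {1..n}" "transports n f (mark_perm n l f) l l"
    if "f \<in> carrier ?A" for f
    using that mark_perm_transports[OF _ _ assms(2) n3] by (auto simp: cA)
  have "\<psi> \<in> hom ?A ?G"
  proof (rule homI)
    fix f assume f: "f \<in> carrier ?A"
    show "\<psi> f \<in> carrier ?G"
      using perm[OF f] g_eqI[OF perm(2)[OF f] perm(1)[OF f] assms(2,2) n3] by (auto simp: cG \<psi>_def G_def)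
  next
    fix f h assume fh: "f \<in> carrier ?A" "h \<in> carrier ?A"
    note pf = perm(1)[OF fh(1)] and ph = perm(1)[OF fh(2)]
    have "f \<otimes>\<^bsub>?A\<^esub> h = f \<circ> h"
      using fh by (auto simp: moebius_stabilizer_def BijGroup_def moebius_Bij compose_def)
    moreover have "mark_perm n l (f \<circ> h) = mark_perm n l f \<circ> mark_perm n l h"
      by (rule mark_perm_unique[OF transports_comp[OF perm(2)[OF fh(2)] perm(2)[OF fh(1)] ph]
            permutes_compose[OF ph pf] assms(2)])
    moreover have "\<psi> f \<otimes>\<^bsub>?G\<^esub> \<psi> h = compose (K n) (\<psi> f) (\<psi> h)"
      using g_Bij[OF n3 pf] g_Bij[OF n3 ph]
      by (simp add: G_stabilizer_def BijGroup_def \<psi>_def)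
    ultimately show "\<psi> (f \<otimes>\<^bsub>?A\<^esub> h) = \<psi> f \<otimes>\<^bsub>?G\<^esub> \<psi> h"
      using compose_g[OF n3 ph pf] by (simp add: \<psi>_def)
  qed
  moreover have "inj_on \<psi> (carrier ?A)"
  proof (rule inj_onI)
    fix f h assume fh: "f \<in> carrier ?A" "h \<in> carrier ?A" "\<psi> f = \<psi> h"
    then have "mark_perm n l f = mark_perm n l h"
      using g_inject[OF assms(1) perm(1)[OF fh(1)] perm(1)[OF fh(2)]] by (simp add: \<psi>_def)
    then show "f = h"
      using transports_unique[OF perm(2)[OF fh(1)] _ assms(2) n3] perm(2)[OF fh(2)] by simp
  qed
  moreover have "carrier ?G \<subseteq> \<psi> ` carrier ?A"
  proof
    fix h assume "h \<in> carrier ?G"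
    then obtain \<sigma> where s: "\<sigma> permutes {1..n}" "h = g n \<sigma>" "g n \<sigma> l = l"
      by (auto simp: cG G_def)
    let ?f = "normalizer_map \<sigma> l"
    have t: "transports n ?f \<sigma> l l"
      using g_transports(2)[OF assms(2) s(1) n3] s by simp
    have "?f \<in> carrier ?A"
      using t transports_stabilizes_points[OF t s(1) n3] by (simp add: cA transports_def)
    moreover have "h = \<psi> ?f" using mark_perm_unique[OF t s(1) assms(2)] s by (simp add: \<psi>_def)
    ultimately show "h \<in> \<psi> ` carrier ?A" by blast
  qed
  ultimately have "\<psi> \<in> iso ?A ?G"
    by (auto simp: iso_def bij_betw_def hom_def)
  then have "?A \<cong> ?G" by (auto simp: is_iso_def)
  then show "?G \<cong> ?A" by (rule group.iso_sym[OF A])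
qed

end
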